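(* If $f:X\to X$ is an equicontinuous homeomorphism of a compact metric space $X$, then $Sh(f)=X^{deg}$.
   Context: Let $f:X\to X$ be a homeomorphism of a metric space $(X,d)$. For $\delta>0$, a bi-infinite sequence $\xi=(\xi_n)_{n\in\mathbb{Z}}$ of points of $X$ is a $\delta$-pseudo-orbit if $d(f(\xi_n),\xi_{n+1})\leq\delta$ for all $n\in\mathbb{Z}$. For $\epsilon>0$, $\xi$ can be $\epsilon$-shadowed if there is $x\in X$ such that $d(f^n(x),\xi_n)\leq\epsilon$ for all $n\in\mathbb{Z}$. A point $x\in X$ is shadowable if for every $\epsilon>0$ there is $\delta>0$ such that every $\delta$-pseudo-orbit $\xi$ with $\xi_0=x$ can be $\epsilon$-shadowed. $Sh(f)$ denotes the set of shadowable points of $f$. The homeomorphism $f$ is equicontinuous if for every $\alpha>0$ there is $\beta>0$ such that $x,y\in X$ and $d(x,y)\leq\beta$ imply $d(f^n(x),f^n(y))\leq\alpha$ for all $n\in\mathbb{Z}$. $X$ is totally disconnected at $p\in X$ if the connected component of $X$ containing $p$ is $\{p\}$, and $X^{deg}=\{p\in X: X\text{ is totally disconnected at }p\}$. *)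

theory Defs
  imports "HOL-Analysis.Analysis"
begin

text \<open>A metric space is a set \<open>X\<close> of points of a type of class \<open>metric_space\<close>, with the restricted
  metric. The values of \<open>f\<close> outside \<open>X\<close> play no role.\<close>

text \<open>The iterate of order \<open>n\<close> of a bijection of \<open>X\<close>, for an integer \<open>n\<close>. The inverse is taken
  relative to \<open>X\<close>, so this is meaningful at points of \<open>X\<close> when \<open>f\<close> is a bijection of \<open>X\<close>.\<close>

definition int_iterate :: "'a set \<Rightarrow> ('a \<Rightarrow> 'a) \<Rightarrow> int \<Rightarrow> 'a \<Rightarrow> 'a" where
  "int_iterate X f n =
     (if n \<ge> 0 then f ^^ nat n else (inv_into X f) ^^ nat (- n))"

definition pseudo_orbit ::
    "'a::metric_space set \<Rightarrow> ('a \<Rightarrow> 'a) \<Rightarrow> real \<Rightarrow> (int \<Rightarrow> 'a) \<Rightarrow> bool" where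
  "pseudo_orbit X f \<delta> \<xi> \<longleftrightarrow>
     (\<forall>n. \<xi> n \<in> X) \<and> (\<forall>n. dist (f (\<xi> n)) (\<xi> (n + 1)) \<le> \<delta>)"

definition can_be_shadowed ::
    "'a::metric_space set \<Rightarrow> ('a \<Rightarrow> 'a) \<Rightarrow> real \<Rightarrow> (int \<Rightarrow> 'a) \<Rightarrow> bool" where
  "can_be_shadowed X f \<epsilon> \<xi> \<longleftrightarrow>
     (\<exists>x\<in>X. \<forall>n. dist (int_iterate X f n x) (\<xi> n) \<le> \<epsilon>)"

definition shadowable_points :: "'a::metric_space set \<Rightarrow> ('a \<Rightarrow> 'a) \<Rightarrow> 'a set" where
  "shadowable_points X f =
     {x \<in> X. \<forall>\<epsilon>>0. \<exists>\<delta>>0. \<forall>\<xi>. pseudo_orbit X f \<delta> \<xi> \<and> \<xi> 0 = x \<longrightarrow> can_be_shadowed X f \<epsilon> \<xi>}"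

definition equicontinuous_homeo :: "'a::metric_space set \<Rightarrow> ('a \<Rightarrow> 'a) \<Rightarrow> bool" where
  "equicontinuous_homeo X f \<longleftrightarrow>
     (\<exists>g. homeomorphism X X f g) \<and>
     (\<forall>\<alpha>>0. \<exists>\<beta>>0. \<forall>x\<in>X. \<forall>y\<in>X. dist x y \<le> \<beta> \<longrightarrow>
        (\<forall>n. dist (int_iterate X f n x) (int_iterate X f n y) \<le> \<alpha>))"

definition degenerate_points :: "'a::topological_space set \<Rightarrow> 'a set" where
  "degenerate_points X = {p \<in> X. connected_component_set X p = {p}}"

end

theory Submission
  imports Defs
begin

text \<open>
  Equicontinuity reduces the question to the identity map. If \<open>\<xi>\<close> is a pseudo-orbit, put
  \<open>\<eta>\<^sub>n = f\<^sup>-\<^sup>n(\<xi>\<^sub>n)\<close>. All integer iterates are uniformly equicontinuous, so up to a change of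
  constants independent of \<open>n\<close>, the sequence \<open>\<xi>\<close> is a pseudo-orbit of \<open>f\<close> iff \<open>\<eta>\<close> moves by
  small steps (that is, \<open>\<eta>\<close> is a pseudo-orbit of the identity), and \<open>\<xi>\<close> is shadowed by the orbit
  of \<open>x\<close> iff every \<open>\<eta>\<^sub>n\<close> is close to \<open>x\<close>. So \<open>p\<close> is shadowable iff sequences of small enough steps
  through \<open>p\<close> cannot leave a given neighbourhood of \<open>p\<close>.

  If the component of \<open>p\<close> is a single point, then compactness gives arbitrarily small clopen
  neighbourhoods of \<open>p\<close>, each at positive distance from its complement
  (\<open>small_clopen_nhd_gap\<close>); steps shorter than this distance never leave it. If on the
  other hand the component contains a second point \<open>q\<close>, then connectedness provides chains from
  \<open>p\<close> to \<open>q\<close> with steps as short as desired (\<open>connected_imp_chain\<close>), and no point is close to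
  both \<open>p\<close> and \<open>q\<close>.
\<close>

section \<open>Integer iterates of a bijection\<close>

lemma funpow_mem:
  assumes "\<And>x. x \<in> X \<Longrightarrow> h x \<in> X" "x \<in> X"
  shows "(h ^^ k) x \<in> X"
  using assms(2) by (induction k) (auto simp: assms(1))

lemma funpow_left_inverse:
  assumes g: "\<And>x. x \<in> X \<Longrightarrow> g x \<in> X" and gh: "\<And>x. x \<in> X \<Longrightarrow> h (g x) = x" and "x \<in> X"
  shows "(h ^^ k) ((g ^^ k) x) = x"
proof (induction k)
  case (Suc k)
  have "(h ^^ Suc k) ((g ^^ Suc k) x) = (h ^^ k) (h (g ((g ^^ k) x)))"
    by (simp add: funpow_swap1)
  then show ?case
    using Suc funpow_mem[OF g \<open>x \<in> X\<close>] gh by simp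
qed simp

context
  fixes X :: "'a set" and f :: "'a \<Rightarrow> 'a"
  assumes bij: "bij_betw f X X"
begin

lemma int_iterate_mem:
  assumes "x \<in> X"
  shows "int_iterate X f n x \<in> X"
  using funpow_mem[of X f x] funpow_mem[of X "inv_into X f" x] assms
    bij_betwE[OF bij] bij_betwE[OF bij_betw_inv_into[OF bij]]
  by (auto simp: int_iterate_def)

lemma int_iterate_minus:
  assumes "x \<in> X"
  shows "int_iterate X f (- n) (int_iterate X f n x) = x"
  using funpow_left_inverse[of X f "inv_into X f" x "nat n"]
    funpow_left_inverse[of X "inv_into X f" f x "nat (- n)"] assms
    bij_betwE[OF bij] bij_betwE[OF bij_betw_inv_into[OF bij]]
    bij_betw_inv_into_left[OF bij] bij_betw_inv_into_right[OF bij]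
  by (auto simp: int_iterate_def)

lemma int_iterate_step:
  assumes "x \<in> X"
  shows "f (int_iterate X f n x) = int_iterate X f (n + 1) x"
proof (cases "n \<ge> 0")
  case True
  then have "nat (n + 1) = Suc (nat n)"
    by simp
  with True show ?thesis
    by (simp add: int_iterate_def)
next
  case False
  define k where "k = nat (- (n + 1))"
  have k: "nat (- n) = Suc k"
    using False by (simp add: k_def)
  have "(inv_into X f ^^ k) x \<in> X"
    using funpow_mem[of X "inv_into X f" x] bij_betwE[OF bij_betw_inv_into[OF bij]] assms by blast
  then have "f (int_iterate X f n x) = (inv_into X f ^^ k) x"
    using False k bij_betw_inv_into_right[OF bij] by (simp add: int_iterate_def)
  also have "\<dots> = int_iterate X f (n + 1) x"
    using False by (cases "n = - 1") (auto simp: int_iterate_def k_def)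
  finally show ?thesis .
qed

end

section \<open>Small steps and connectedness\<close>

text \<open>
  Being joined by a finite \<open>\<gamma>\<close>-chain is an equivalence relation with open classes, so a connected
  set has only one class. The chain is prolonged by the constant \<open>q\<close> so that it can be
  turned into a pseudo-orbit, which is infinite.
\<close>
lemma connected_imp_chain:
  fixes C :: "'a::metric_space set"
  assumes "connected C" "p \<in> C" "q \<in> C" "\<gamma> > 0"
  obtains c :: "nat \<Rightarrow> 'a" and m where "c 0 = p" "\<And>i. i \<ge> m \<Longrightarrow> c i = q" "\<And>i. c i \<in> C"
    "\<And>i. dist (c i) (c (Suc i)) \<le> \<gamma>"
proof -
  define R where "R = (\<lambda>x y. x \<in> C \<and> y \<in> C \<and> dist x y \<le> \<gamma>)"
  have "R\<^sup>*\<^sup>* p q"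
  proof (rule connected_equivalence_relation[OF assms(1-3)])
    have "symp R"
      by (auto simp: symp_def R_def dist_commute)
    then show "R\<^sup>*\<^sup>* y x" if "R\<^sup>*\<^sup>* x y" for x y
      using that by (meson symp_rtranclp sympD)
    show "\<exists>T. openin (top_of_set C) T \<and> a \<in> T \<and> (\<forall>x\<in>T. R\<^sup>*\<^sup>* a x)" if "a \<in> C" for a
    proof (intro exI conjI ballI)
      show "openin (top_of_set C) (C \<inter> ball a \<gamma>)"
        by (simp add: openin_open_Int)
      show "a \<in> C \<inter> ball a \<gamma>"
        using that \<open>\<gamma> > 0\<close> by simp
      show "R\<^sup>*\<^sup>* a x" if "x \<in> C \<inter> ball a \<gamma>" for x
        using that \<open>a \<in> C\<close> by (intro r_into_rtranclp) (auto simp: R_def)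
    qed
  qed (rule rtranclp_trans)
  then obtain m d where d: "d 0 = p" "d m = q" "\<And>i. i < m \<Longrightarrow> R (d i) (d (Suc i))"
    by (auto simp: rtranclp_power relpowp_fun_conv)
  have mem: "d i \<in> C" if "i \<le> m" for i
    using that d assms(3) by (cases "i = m") (auto simp: R_def)
  show thesis
  proof (rule that[of "\<lambda>i. d (min i m)" m])
    show "dist (d (min i m)) (d (min (Suc i) m)) \<le> \<gamma>" for i
      using d(3)[of i] \<open>\<gamma> > 0\<close> by (cases "i < m") (auto simp: R_def min_def)
  qed (auto simp: d mem)
qed

text \<open>
  In a compact Hausdorff space the component of a point is the intersection of the clopen sets
  that contain it (components are quasi-components), and a quasi-component can be separated by a
  clopen partition from any compact set disjoint from it, here the complement of a ball. A
  Lebesgue number of the partition is a gap between its two parts.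
\<close>
lemma small_clopen_nhd_gap:
  fixes X :: "'a::metric_space set"
  assumes "compact X" and comp: "connected_component_set X p = {p}" and "\<alpha> > 0"
  obtains U \<gamma> where "\<gamma> > 0" "p \<in> U" "U \<subseteq> ball p \<alpha>"
    "\<And>x y. \<lbrakk>x \<in> U; y \<in> X; dist x y \<le> \<gamma>\<rbrakk> \<Longrightarrow> y \<in> U"
proof -
  have "connected_component X p p"
    using comp by auto
  then have "p \<in> X"
    by (simp add: connected_component_refl_eq)
  have "connected_component_of_set (top_of_set X) p = {p}"
    using comp
    by (simp add: set_eq_iff connected_component_of_def connected_component_def
        connectedin_subtopology conj_ac)
  moreover have "quasi_component_of (top_of_set X) p = connected_component_of (top_of_set X) p"
    using \<open>compact X\<close>
    by (intro quasi_eq_connected_component_of)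
      (simp add: compact_space_subtopology Hausdorff_space_subtopology)
  ultimately have "{p} \<in> quasi_components_of (top_of_set X)"
    using quasi_component_in_quasi_components_of[of "top_of_set X" p] \<open>p \<in> X\<close> by simp
  moreover have "compactin (top_of_set X) (X - ball p \<alpha>)"
    using \<open>compact X\<close> by (simp add: compactin_subtopology compact_diff)
  ultimately have "separated_between (top_of_set X) {p} (X - ball p \<alpha>)"
    using \<open>\<alpha> > 0\<close> by (simp add: separated_between_quasi_component_compact)
  then obtain U V where U: "openin (top_of_set X) U" and V: "openin (top_of_set X) V"
    and UV: "U \<union> V = X" "disjnt U V" "p \<in> U" "X - ball p \<alpha> \<subseteq> V"
    by (auto simp: separated_between_def)
  then obtain W W' where W: "open W" "U = X \<inter> W" "open W'" "V = X \<inter> W'"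
    by (auto simp: openin_open)
  then have "X \<subseteq> \<Union>{W, W'}" and "\<And>B. B \<in> {W, W'} \<Longrightarrow> open B"
    using UV(1) by auto
  then obtain e where e: "e > 0" "\<And>x. x \<in> X \<Longrightarrow> \<exists>B\<in>{W, W'}. ball x e \<subseteq> B"
    using Heine_Borel_lemma[OF \<open>compact X\<close>, of "{W, W'}"] by metis
  show thesis
  proof (rule that[of "e / 2" U])
    show "y \<in> U" if "x \<in> U" "y \<in> X" "dist x y \<le> e / 2" for x y
    proof -
      have "x \<in> X" "x \<notin> W'"
        using \<open>x \<in> U\<close> W UV(2) by (auto simp: disjnt_def)
      then have "ball x e \<subseteq> W"
        using e(1) e(2)[of x] centre_in_ball[of x e] by blast
      moreover have "y \<in> ball x e"
        using that(3) e(1) by simp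
      ultimately show ?thesis
        using W(2) \<open>y \<in> X\<close> by blast
    qed
    show "U \<subseteq> ball p \<alpha>"
      using UV W by (auto simp: disjnt_def)
  qed (use e(1) UV(3) in auto)
qed

section \<open>Shadowing for equicontinuous homeomorphisms\<close>

lemma equicontinuous_homeo_bij_betw:
  assumes "equicontinuous_homeo X f"
  shows "bij_betw f X X"
  using assms unfolding equicontinuous_homeo_def homeomorphism_def
  by (auto intro!: bij_betw_byWitness)

lemma equicontinuous_homeoE:
  assumes "equicontinuous_homeo X f" "\<alpha> > 0"
  obtains \<beta> where "\<beta> > 0" "\<And>x y n. \<lbrakk>x \<in> X; y \<in> X; dist x y \<le> \<beta>\<rbrakk> \<Longrightarrow>
    dist (int_iterate X f n x) (int_iterate X f n y) \<le> \<alpha>"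
  using assms unfolding equicontinuous_homeo_def by meson

text \<open>
  The orbit of \<open>p\<close> itself does the shadowing: the pulled back sequence stays in a clopen
  neighbourhood of \<open>p\<close>, and pushing it forward again keeps it close to the orbit of \<open>p\<close>.
\<close>
lemma degenerate_imp_shadowable:
  assumes "compact X" and eq: "equicontinuous_homeo X f" and p: "p \<in> degenerate_points X"
  shows "p \<in> shadowable_points X f"
proof -
  note bij = equicontinuous_homeo_bij_betw[OF eq]
  let ?it = "int_iterate X f"
  have "p \<in> X" and comp: "connected_component_set X p = {p}"
    using p by (auto simp: degenerate_points_def)
  have "\<exists>\<delta>>0. \<forall>\<xi>. pseudo_orbit X f \<delta> \<xi> \<and> \<xi> 0 = p \<longrightarrow> can_be_shadowed X f \<epsilon> \<xi>" if "\<epsilon> > 0" for \<epsilon>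
  proof -
    obtain \<alpha> where \<alpha>: "\<alpha> > 0" "\<And>x y n. \<lbrakk>x \<in> X; y \<in> X; dist x y \<le> \<alpha>\<rbrakk> \<Longrightarrow> dist (?it n x) (?it n y) \<le> \<epsilon>"
      using equicontinuous_homeoE[OF eq \<open>\<epsilon> > 0\<close>] by blast
    obtain U \<gamma> where U: "\<gamma> > 0" "p \<in> U" "U \<subseteq> ball p \<alpha>"
      "\<And>x y. \<lbrakk>x \<in> U; y \<in> X; dist x y \<le> \<gamma>\<rbrakk> \<Longrightarrow> y \<in> U"
      "\<And>x y. \<lbrakk>y \<in> U; x \<in> X; dist x y \<le> \<gamma>\<rbrakk> \<Longrightarrow> x \<in> U"
      using small_clopen_nhd_gap[OF \<open>compact X\<close> comp \<alpha>(1)] by (metis dist_commute)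
    obtain \<delta> where \<delta>: "\<delta> > 0" "\<And>x y n. \<lbrakk>x \<in> X; y \<in> X; dist x y \<le> \<delta>\<rbrakk> \<Longrightarrow> dist (?it n x) (?it n y) \<le> \<gamma>"
      using equicontinuous_homeoE[OF eq U(1)] by blast
    have "can_be_shadowed X f \<epsilon> \<xi>" if \<xi>: "pseudo_orbit X f \<delta> \<xi>" "\<xi> 0 = p" for \<xi>
    proof -
      define \<eta> where "\<eta> n = ?it (- n) (\<xi> n)" for n
      have \<xi>_mem: "\<xi> n \<in> X" for n
        using \<xi> by (simp add: pseudo_orbit_def)
      have \<eta>_mem: "\<eta> n \<in> X" for n
        by (simp add: \<eta>_def int_iterate_mem[OF bij] \<xi>_mem)
      have it_\<eta>: "?it n (\<eta> n) = \<xi> n" for n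
        using int_iterate_minus[OF bij \<xi>_mem, of "- n"] by (simp add: \<eta>_def)
      \<comment> \<open>Both points are images under the iterate of order \<open>- (n + 1)\<close>, of \<open>f (\<xi> n)\<close> and \<open>\<xi> (n + 1)\<close>.\<close>
      have step: "dist (\<eta> n) (\<eta> (n + 1)) \<le> \<gamma>" for n
      proof -
        have f\<xi>: "f (\<xi> n) = ?it (n + 1) (\<eta> n)"
          using int_iterate_step[OF bij \<eta>_mem] it_\<eta> by metis
        then have "?it (- (n + 1)) (f (\<xi> n)) = \<eta> n"
          using int_iterate_minus[OF bij \<eta>_mem] by metis
        moreover have "f (\<xi> n) \<in> X"
          by (simp add: f\<xi> int_iterate_mem[OF bij] \<eta>_mem)
        ultimately show ?thesis
          using \<delta>(2)[of "f (\<xi> n)" "\<xi> (n + 1)" "- (n + 1)"] \<xi> \<xi>_mem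
          by (simp add: pseudo_orbit_def \<eta>_def)
      qed
      have "\<eta> n \<in> U" for n
      proof (induction n rule: int_induct[where k = 0])
        case base
        then show ?case
          using \<xi> U(2) by (simp add: \<eta>_def int_iterate_def)
      next
        case (step1 i)
        then show ?case
          using U(4) \<eta>_mem step by blast
      next
        case (step2 i)
        then show ?case
          using U(5)[of "\<eta> i" "\<eta> (i - 1)"] \<eta>_mem step[of "i - 1"] by simp
      qed
      then have "dist p (\<eta> n) \<le> \<alpha>" for n
        using U(3) by (meson less_imp_le mem_ball subsetD)
      then have "dist (?it n p) (\<xi> n) \<le> \<epsilon>" for n
        using \<alpha>(2)[OF \<open>p \<in> X\<close> \<eta>_mem] it_\<eta>[of n] by metis
      with \<open>p \<in> X\<close> show ?thesis
        by (auto simp: can_be_shadowed_def)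
    qed
    with \<delta>(1) show ?thesis
      by blast
  qed
  with \<open>p \<in> X\<close> show ?thesis
    by (simp add: shadowable_points_def)
qed

text \<open>
  Pushing a chain from \<open>p\<close> to \<open>q\<close> forward gives a pseudo-orbit that starts on the orbit of \<open>p\<close> and
  ends on the orbit of \<open>q\<close>. A point shadowing it is near \<open>p\<close> at time \<open>0\<close>, and near \<open>q\<close>
  because nearness to the orbit of \<open>q\<close> at a late time can be pulled back to time \<open>0\<close>.
\<close>
lemma shadowable_imp_degenerate:
  assumes eq: "equicontinuous_homeo X f" and p: "p \<in> shadowable_points X f"
  shows "p \<in> degenerate_points X"
proof -
  note bij = equicontinuous_homeo_bij_betw[OF eq]
  let ?it = "int_iterate X f"
  have "p \<in> X"
    using p by (simp add: shadowable_points_def)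
  have "q = p" if pq: "connected_component X p q" for q
  proof (rule ccontr)
    assume "q \<noteq> p"
    obtain C where C: "connected C" "C \<subseteq> X" "p \<in> C" "q \<in> C"
      using pq by (auto simp: connected_component_def)
    \<comment> \<open>A shadowing point will be within \<open>\<alpha>\<close> of \<open>p\<close> and of \<open>q\<close>; a third of their distance is too little.\<close>
    define \<alpha> where "\<alpha> = dist p q / 3"
    have "\<alpha> > 0"
      using \<open>q \<noteq> p\<close> by (simp add: \<alpha>_def)
    then obtain \<beta> where \<beta>: "\<beta> > 0" "\<And>x y n. \<lbrakk>x \<in> X; y \<in> X; dist x y \<le> \<beta>\<rbrakk> \<Longrightarrow> dist (?it n x) (?it n y) \<le> \<alpha>"
      using equicontinuous_homeoE[OF eq] by blast
    \<comment> \<open>The bound by \<open>\<alpha>\<close> serves at time \<open>0\<close>, the bound by \<open>\<beta>\<close> at the late time to be pulled back.\<close>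
    define \<epsilon> where "\<epsilon> = min \<alpha> \<beta>"
    have "\<epsilon> > 0"
      using \<open>\<alpha> > 0\<close> \<open>\<beta> > 0\<close> by (simp add: \<epsilon>_def)
    then obtain \<delta> where "\<delta> > 0"
      and \<delta>: "\<And>\<xi>. \<lbrakk>pseudo_orbit X f \<delta> \<xi>; \<xi> 0 = p\<rbrakk> \<Longrightarrow> can_be_shadowed X f \<epsilon> \<xi>"
      using p unfolding shadowable_points_def by blast
    obtain \<gamma> where \<gamma>: "\<gamma> > 0" "\<And>x y n. \<lbrakk>x \<in> X; y \<in> X; dist x y \<le> \<gamma>\<rbrakk> \<Longrightarrow> dist (?it n x) (?it n y) \<le> \<delta>"
      using equicontinuous_homeoE[OF eq \<open>\<delta> > 0\<close>] by blast
    obtain c m where c: "c 0 = p" "\<And>i. i \<ge> m \<Longrightarrow> c i = q" "\<And>i. c i \<in> C"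
      "\<And>i. dist (c i) (c (Suc i)) \<le> \<gamma>"
      using connected_imp_chain[OF C(1,3,4) \<gamma>(1)] by blast
    have c_mem: "c i \<in> X" for i
      using c(3) C(2) by blast
    \<comment> \<open>For negative \<open>n\<close> the truncation \<open>nat n = 0\<close> makes \<open>\<xi>\<close> follow the backward orbit of \<open>p\<close>.\<close>
    define \<xi> where "\<xi> n = ?it n (c (nat n))" for n
    have "dist (f (\<xi> n)) (\<xi> (n + 1)) \<le> \<delta>" for n
    proof -
      have "dist (c (nat n)) (c (nat (n + 1))) \<le> \<gamma>"
        using c(4)[of "nat n"] \<gamma>(1) by (cases "n \<ge> 0") (auto simp: nat_add_distrib)
      then show ?thesis
        using \<gamma>(2)[OF c_mem c_mem] by (simp add: \<xi>_def int_iterate_step[OF bij c_mem])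
    qed
    then have "pseudo_orbit X f \<delta> \<xi>"
      by (simp add: pseudo_orbit_def \<xi>_def int_iterate_mem[OF bij c_mem])
    moreover have "\<xi> 0 = p"
      by (simp add: \<xi>_def int_iterate_def c(1))
    ultimately obtain x where "x \<in> X" and x: "\<And>n. dist (?it n x) (\<xi> n) \<le> \<epsilon>"
      using \<delta> unfolding can_be_shadowed_def by blast
    have "q \<in> X"
      using C by blast
    have "dist x p \<le> \<alpha>"
      using x[of 0] \<open>\<xi> 0 = p\<close> by (simp add: int_iterate_def \<epsilon>_def)
    moreover have "dist x q \<le> \<alpha>"
    proof -
      have "dist (?it (int m) x) (?it (int m) q) \<le> \<beta>"
        using x[of "int m"] by (simp add: \<xi>_def c(2) \<epsilon>_def)
      then have "dist (?it (- int m) (?it (int m) x)) (?it (- int m) (?it (int m) q)) \<le> \<alpha>"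
        by (intro \<beta>(2) int_iterate_mem[OF bij] \<open>x \<in> X\<close> \<open>q \<in> X\<close>)
      then show ?thesis
        by (simp add: int_iterate_minus[OF bij] \<open>x \<in> X\<close> \<open>q \<in> X\<close>)
    qed
    ultimately have "dist p q \<le> 2 * \<alpha>"
      using dist_triangle3[of p q x] by simp
    with \<open>\<alpha> > 0\<close> show False
      by (simp add: \<alpha>_def)
  qed
  with \<open>p \<in> X\<close> show ?thesis
    by (auto simp: degenerate_points_def)
qed

theorem theorem1p9:
  fixes X :: "'a::metric_space set" and f :: "'a \<Rightarrow> 'a"
  assumes "compact X"
    and "equicontinuous_homeo X f"
  shows "shadowable_points X f = degenerate_points X"
  using degenerate_imp_shadowable shadowable_imp_degenerate assms by blast

end
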